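(* Let $\epsilon,\delta,\eta,\nu>0$ and set $r=\frac{8\ln(2/\nu)}{\eta^2}$ and $w=\frac{16\sqrt{r\ln(2/\delta)}}{\epsilon}\ln(16r/\delta)$. Let $A$ be a real $n\times d$ matrix whose rows have mean $0$ (i.e. $\frac1n\mathbf 1^{\mathsf T}A=0$), and let $\tilde C$ be the output of the following randomized algorithm (Algorithm 3) on $A$: subtract the mean row from $A$; compute an SVD $A=U\Sigma V^{\mathsf T}$; replace $A$ by $U\sqrt{\Sigma^2+w^2I_{n\times d}}\,V^{\mathsf T}$ (the $n\times d$ diagonal matrix with entries $\sqrt{\sigma_i^2+w^2}$); pick an $r\times n$ matrix $M$ with i.i.d. $\mathcal N(0,1)$ entries; output $\tilde C=\frac1rA^{\mathsf T}M^{\mathsf T}MA$. For a unit vector $x\in\mathbb R^d$ define (Algorithm 4) $R(x)=x^{\mathsf T}\tilde Cx-w^2$. Then $R$ is an $(\eta,\tau,\nu)$-approximation for directional variance queries: for every unit-length $x\in\mathbb R^d$, $$\Pr\left[(1-\eta)\Phi_A(x)-\tau\le R(x)\le(1+\eta)\Phi_A(x)+\tau\right]\ge1-\nu,$$ where $\Phi_A(x)=x^{\mathsf T}A^{\mathsf T}Ax$ (for the original, mean-centered $A$) and $\tau=O\!\left(\frac{\ln(1/\delta)\ln(1/\nu)}{\epsilon^2\eta}\ln^2\!\left(\frac{\ln(1/\nu)}{\delta\eta^2}\right)\right)$.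
   Context: $\mathbf 1$ is the all-ones vector in $\mathbb R^n$; $I_{n\times d}$ is the $n\times d$ matrix with ones on its main diagonal and zeros elsewhere. The $O(\cdot)$ hides an absolute constant; the probability is over the randomness of $M$. The paper's algorithm normalizes $A$ so that the mean of its rows is $0$, and $\Phi_A$ refers to this normalized matrix.
   Formalization: The formal version assumes d ≤ n and η ≤ 1, claims the O-bound on τ only for δ, ν ≤ 1/2, and rounds r up to an integer; without such restrictions the claim fails (e.g. for n < d, R(x) = −w² with Φ_A(x) = 0 for some unit x). *)

theory Defs
  imports "HOL-Probability.Probability" "Jordan_Normal_Form.Matrix"
begin

no_notation inner (infixl \<open>\<bullet>\<close> 70)
no_notation vec_nth (infixl \<open>$\<close> 90)

type_synonym rmat = "real Matrix.mat"
type_synonym rvec = "real Matrix.vec"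

definition mean_row :: "rmat \<Rightarrow> rvec" where
  "mean_row A = Matrix.vec (dim_col A)
     (\<lambda>j. (1 / real (dim_row A)) * (\<Sum>i<dim_row A. A $$ (i, j)))"

definition center_rows :: "rmat \<Rightarrow> rmat" where
  "center_rows A = Matrix.mat (dim_row A) (dim_col A) (\<lambda>(i, j). A $$ (i, j) - mean_row A $ j)"

text \<open>Full singular value decomposition. The singular values are not required to be sorted, so
  whatever is proved for every such decomposition holds in particular for the sorted ones.\<close>

definition is_svd :: "rmat \<Rightarrow> rmat \<Rightarrow> rmat \<Rightarrow> rmat \<Rightarrow> bool" where
  "is_svd A U S V \<longleftrightarrow>
     U \<in> carrier_mat (dim_row A) (dim_row A) \<and> inverts_mat U (transpose_mat U) \<and>
     V \<in> carrier_mat (dim_col A) (dim_col A) \<and> inverts_mat V (transpose_mat V) \<and>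
     S \<in> carrier_mat (dim_row A) (dim_col A) \<and> diagonal_mat S \<and>
     (\<forall>i < min (dim_row A) (dim_col A). 0 \<le> S $$ (i, i)) \<and>
     A = U * S * transpose_mat V"

definition shift_singular_values :: "real \<Rightarrow> rmat \<Rightarrow> rmat" where
  "shift_singular_values w S = Matrix.mat (dim_row S) (dim_col S)
     (\<lambda>(i, j). if i = j then sqrt ((S $$ (i, i))\<^sup>2 + w\<^sup>2) else 0)"

text \<open>Number of rows of the random projection: \<open>8 ln(2/\<nu>)/\<eta>\<^sup>2\<close> rounded up to an integer.
  The rounded value is used wherever the algorithm refers to \<open>r\<close>.\<close>

definition proj_dim :: "real \<Rightarrow> real \<Rightarrow> nat" where
  "proj_dim \<eta> \<nu> = nat \<lceil>8 * ln (2 / \<nu>) / \<eta>\<^sup>2\<rceil>"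

definition noise_level :: "real \<Rightarrow> real \<Rightarrow> real \<Rightarrow> real \<Rightarrow> real" where
  "noise_level \<epsilon> \<delta> \<eta> \<nu> =
     (let r = real (proj_dim \<eta> \<nu>)
      in 16 * sqrt (r * ln (2 / \<delta>)) / \<epsilon> * ln (16 * r / \<delta>))"

text \<open>An \<open>r \<times> n\<close> matrix with i.i.d. standard normal entries: \<open>gaussian_entries r n\<close> is the joint law of
  the entries, and \<open>gaussian_mat r n\<close> arranges a sample as a matrix.\<close>

definition gaussian_entries :: "nat \<Rightarrow> nat \<Rightarrow> (nat \<times> nat \<Rightarrow> real) measure" where
  "gaussian_entries r n =
     Pi\<^sub>M ({..<r} \<times> {..<n}) (\<lambda>_. density lborel (\<lambda>t. ennreal (std_normal_density t)))"

definition gaussian_mat :: "nat \<Rightarrow> nat \<Rightarrow> (nat \<times> nat \<Rightarrow> real) \<Rightarrow> rmat" where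
  "gaussian_mat r n \<omega> = Matrix.mat r n \<omega>"

text \<open>Released covariance matrix, as a function of the chosen decomposition \<open>U S V\<^sup>T\<close> of the centered
  input and of the drawn projection \<open>M\<close>, whose number of rows is \<open>r\<close>.\<close>

definition released_cov :: "real \<Rightarrow> rmat \<Rightarrow> rmat \<Rightarrow> rmat \<Rightarrow> rmat \<Rightarrow> rmat" where
  "released_cov w U S V M =
     (let B = U * shift_singular_values w S * transpose_mat V
      in (1 / real (dim_row M)) \<cdot>\<^sub>m (transpose_mat B * transpose_mat M * M * B))"

definition answer_query :: "real \<Rightarrow> rmat \<Rightarrow> rvec \<Rightarrow> real" where
  "answer_query w C x = x \<bullet> (C *\<^sub>v x) - w\<^sup>2"

definition directional_variance :: "rmat \<Rightarrow> rvec \<Rightarrow> real" where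
  "directional_variance A x = x \<bullet> ((transpose_mat A * A) *\<^sub>v x)"

definition approximates_directional_variance ::
  "'w measure \<Rightarrow> ('w \<Rightarrow> rvec \<Rightarrow> real) \<Rightarrow> rmat \<Rightarrow> real \<Rightarrow> real \<Rightarrow> real \<Rightarrow> bool" where
  "approximates_directional_variance P R A \<eta> \<tau> \<nu> \<longleftrightarrow>
     (\<forall>x \<in> carrier_vec (dim_col A). sqrt (x \<bullet> x) = 1 \<longrightarrow>
        \<P>(\<omega> in P. (1 - \<eta>) * directional_variance A x - \<tau> \<le> R \<omega> x \<and>
                 R \<omega> x \<le> (1 + \<eta>) * directional_variance A x + \<tau>) \<ge> 1 - \<nu>)"

end

theory Submission
  imports Defs "Jordan_Normal_Form.Determinant"
begin

text \<open>Let \<open>B\<close> be the matrix with shifted singular values. Orthogonality of \<open>U\<close> and \<open>V\<close> and \<open>d \<le> n\<close> give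
  \<open>\<parallel>B x\<parallel>\<^sup>2 = \<Phi>\<^sub>A(x) + w\<^sup>2\<close> for every unit vector \<open>x\<close>, and \<open>R(x) + w\<^sup>2 = \<parallel>M B x\<parallel>\<^sup>2 / r\<close>, where the entries
  of \<open>M B x\<close> are independent centered normal variables of variance \<open>\<parallel>B x\<parallel>\<^sup>2\<close>. Hence the Chernoff bound
  for the chi-squared distribution shows that \<open>R(x) + w\<^sup>2\<close> lies within a factor \<open>1 \<plusminus> \<eta>\<close> of
  \<open>\<Phi>\<^sub>A(x) + w\<^sup>2\<close> except with probability \<open>2 exp(-r \<eta>\<^sup>2 / 8) \<le> \<nu>\<close>, so \<open>\<tau> = \<eta> w\<^sup>2\<close> works.\<close>

section \<open>Chi-squared concentration\<close>

text \<open>The difference of the two sides vanishes at 0 and has a nonnegative derivative up to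
  1/2. The bound serves the upper tail below.\<close>

lemma ln_one_minus_ge:
  fixes x :: real
  assumes "0 \<le> x" "x \<le> 1 / 2"
  shows "- x - x\<^sup>2 \<le> ln (1 - x)"
proof -
  let ?f = "\<lambda>t::real. ln (1 - t) + t + t\<^sup>2"
  have "?f 0 \<le> ?f x"
  proof (rule DERIV_nonneg_imp_nondecreasing[OF assms(1)])
    fix t :: real assume t: "0 \<le> t" "t \<le> x"
    with assms have t1: "t < 1" "2 * t \<le> 1" by linarith+
    have "(?f has_real_derivative t * (1 - 2 * t) / (1 - t)) (at t)"
      using t1 by (auto intro!: derivative_eq_intros simp: field_simps)
    moreover have "0 \<le> t * (1 - 2 * t) / (1 - t)"
      using t t1 by simp
    ultimately show "\<exists>y. (?f has_real_derivative y) (at t) \<and> 0 \<le> y" by blast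
  qed
  then show ?thesis by simp
qed

text \<open>Moment generating function of a squared standard normal variable. Multiplying the
  density by \<open>exp (s * x\<^sup>2)\<close> gives \<open>1 / sqrt (1 - 2 * s)\<close> times the
  centered normal density with standard deviation \<open>1 / sqrt (1 - 2 * s)\<close>, which has
  mass 1.\<close>

lemma nn_integral_std_normal_exp_square:
  fixes s :: real
  assumes s: "s < 1 / 2"
  shows "(\<integral>\<^sup>+x. ennreal (std_normal_density x) * ennreal (exp (s * x\<^sup>2)) \<partial>lborel) =
    ennreal ((1 - 2 * s) powr (- 1 / 2))"
proof -
  define c where "c = sqrt (1 - 2 * s)"
  have c: "c > 0" "c\<^sup>2 = 1 - 2 * s" using s by (auto simp: c_def)
  have "std_normal_density x * exp (s * x\<^sup>2) = inverse c * normal_density 0 (1 / c) x" for x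
  proof -
    have "- x\<^sup>2 / 2 + s * x\<^sup>2 = - (c\<^sup>2 * x\<^sup>2) / 2"
      unfolding c(2) by (simp add: field_simps)
    moreover have "sqrt (2 * pi * (1 / c)\<^sup>2) = sqrt (2 * pi) / c"
      using c(1) by (simp add: real_sqrt_mult real_sqrt_divide power_divide)
    ultimately show ?thesis
      using c(1) unfolding normal_density_def
      by (simp add: exp_add[symmetric] power_divide field_simps)
  qed
  then have "(\<integral>\<^sup>+x. ennreal (std_normal_density x) * ennreal (exp (s * x\<^sup>2)) \<partial>lborel) =
      (\<integral>\<^sup>+x. ennreal (inverse c) * ennreal (normal_density 0 (1 / c) x) \<partial>lborel)"
    using c by (simp add: ennreal_mult[symmetric])
  also have "\<dots> = ennreal (inverse c) * (\<integral>\<^sup>+x. ennreal (normal_density 0 (1 / c) x) \<partial>lborel)"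
    by (rule nn_integral_cmult) simp
  also have "(\<integral>\<^sup>+x. ennreal (normal_density 0 (1 / c) x) \<partial>lborel) = 1"
    using c by (subst nn_integral_eq_integral) (auto intro: integrable_normal_density)
  finally show ?thesis
    using s by (simp add: c_def powr_half_sqrt[symmetric] powr_minus)
qed

text \<open>By independence the integral of the product of exponentials factors. Nonnegative
  integrals avoid integrability obligations.\<close>

lemma (in prob_space) nn_integral_exp_sum_squares_std_normal:
  fixes X :: "'i \<Rightarrow> 'a \<Rightarrow> real" and s :: real
  assumes I: "finite I" and ind: "indep_vars (\<lambda>_. borel) X I"
    and X: "\<And>i. i \<in> I \<Longrightarrow> distributed M lborel (X i) std_normal_density"
    and s: "s < 1 / 2"
  shows "(\<integral>\<^sup>+\<omega>. ennreal (exp (s * (\<Sum>i\<in>I. (X i \<omega>)\<^sup>2))) \<partial>M) =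
    ennreal ((1 - 2 * s) powr (- real (card I) / 2))"
proof -
  have "(\<integral>\<^sup>+\<omega>. ennreal (exp (s * (\<Sum>i\<in>I. (X i \<omega>)\<^sup>2))) \<partial>M) =
      (\<integral>\<^sup>+\<omega>. (\<Prod>i\<in>I. ennreal (exp (s * (X i \<omega>)\<^sup>2))) \<partial>M)"
    using I by (simp add: sum_distrib_left exp_sum prod_ennreal)
  also have "\<dots> = (\<Prod>i\<in>I. \<integral>\<^sup>+\<omega>. ennreal (exp (s * (X i \<omega>)\<^sup>2)) \<partial>M)"
    using I by (intro indep_vars_nn_integral indep_vars_compose2[OF ind]) auto
  also have "\<dots> = (\<Prod>i\<in>I. ennreal ((1 - 2 * s) powr (- 1 / 2)))"
  proof (rule prod.cong[OF refl])
    fix i assume "i \<in> I"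
    from distributed_nn_integral[OF X[OF this], of "\<lambda>x. ennreal (exp (s * x\<^sup>2))"]
    show "(\<integral>\<^sup>+\<omega>. ennreal (exp (s * (X i \<omega>)\<^sup>2)) \<partial>M) = ennreal ((1 - 2 * s) powr (- 1 / 2))"
      using nn_integral_std_normal_exp_square[OF s] by simp
  qed
  also have "\<dots> = ennreal ((1 - 2 * s) powr (- real (card I) / 2))"
    using s by (simp add: ennreal_power powr_power)
  finally show ?thesis .
qed

text \<open>Chernoff's method. Keeping the factor \<open>s\<close> in the event covers both tails:
  positive \<open>s\<close> gives the upper one, negative \<open>s\<close> the lower one.\<close>

lemma (in prob_space) prob_sum_squares_std_normal_tail:
  fixes X :: "'i \<Rightarrow> 'a \<Rightarrow> real" and s a :: real
  assumes I: "finite I" and ind: "indep_vars (\<lambda>_. borel) X I"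
    and X: "\<And>i. i \<in> I \<Longrightarrow> distributed M lborel (X i) std_normal_density"
    and s: "s < 1 / 2"
  shows "prob {\<omega>\<in>space M. s * a \<le> s * (\<Sum>i\<in>I. (X i \<omega>)\<^sup>2)} \<le>
    exp (- (s * a) - real (card I) / 2 * ln (1 - 2 * s))"
proof -
  have [measurable]: "random_variable borel (X i)" if "i \<in> I" for i
    using ind that by (auto simp: indep_vars_def)
  have "emeasure M {\<omega>\<in>space M. s * a \<le> s * (\<Sum>i\<in>I. (X i \<omega>)\<^sup>2)} \<le> ennreal (exp (- (s * a))) *
      (\<integral>\<^sup>+\<omega>. ennreal (exp (s * (\<Sum>i\<in>I. (X i \<omega>)\<^sup>2))) * indicator (space M) \<omega> \<partial>M)"
    using Chernoff_ineq_nn_integral_ge[of 1 "space M" M "\<lambda>\<omega>. s * (\<Sum>i\<in>I. (X i \<omega>)\<^sup>2)" "s * a"]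
    by simp
  also have "(\<integral>\<^sup>+\<omega>. ennreal (exp (s * (\<Sum>i\<in>I. (X i \<omega>)\<^sup>2))) * indicator (space M) \<omega> \<partial>M) =
      (\<integral>\<^sup>+\<omega>. ennreal (exp (s * (\<Sum>i\<in>I. (X i \<omega>)\<^sup>2))) \<partial>M)"
    by (rule nn_integral_cong) simp
  also have "\<dots> = ennreal ((1 - 2 * s) powr (- real (card I) / 2))"
    by (rule nn_integral_exp_sum_squares_std_normal[OF I ind X s])
  also have "ennreal (exp (- (s * a))) * \<dots> =
      ennreal (exp (- (s * a) - real (card I) / 2 * ln (1 - 2 * s)))"
    using s by (simp add: ennreal_mult[symmetric] powr_def exp_add[symmetric])
  finally show ?thesis
    by (simp add: emeasure_eq_measure)
qed

lemma (in prob_space) prob_sum_squares_std_normal_concentration: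
  fixes X :: "'i \<Rightarrow> 'a \<Rightarrow> real" and \<eta> :: real
  assumes I: "finite I" and ind: "indep_vars (\<lambda>_. borel) X I"
    and X: "\<And>i. i \<in> I \<Longrightarrow> distributed M lborel (X i) std_normal_density"
    and \<eta>: "0 < \<eta>" "\<eta> \<le> 1"
  shows "prob {\<omega>\<in>space M. (1 - \<eta>) * real (card I) \<le> (\<Sum>i\<in>I. (X i \<omega>)\<^sup>2) \<and>
      (\<Sum>i\<in>I. (X i \<omega>)\<^sup>2) \<le> (1 + \<eta>) * real (card I)} \<ge>
    1 - 2 * exp (- (real (card I) * \<eta>\<^sup>2 / 8))"
proof -
  let ?n = "real (card I)" and ?Z = "\<lambda>\<omega>. \<Sum>i\<in>I. (X i \<omega>)\<^sup>2"
  let ?E = "\<lambda>s a. {\<omega>\<in>space M. s * a \<le> s * ?Z \<omega>}"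
  let ?G = "{\<omega>\<in>space M. (1 - \<eta>) * ?n \<le> ?Z \<omega> \<and> ?Z \<omega> \<le> (1 + \<eta>) * ?n}"
  have [measurable]: "random_variable borel (X i)" if "i \<in> I" for i
    using ind that by (auto simp: indep_vars_def)
  \<comment> \<open>With \<open>s = \<eta> / 4\<close> and the quadratic bound on the logarithm, the
    terms linear in \<eta> cancel, and \<open>?n * \<eta>\<^sup>2\<close> keeps the coefficient -1/4
    + 1/8 = -1/8. The assumption \<eta> \<le> 1 puts \<open>\<eta> / 2\<close> in the range of that
    bound.\<close>
  have upper: "prob (?E (\<eta> / 4) ((1 + \<eta>) * ?n)) \<le> exp (- (?n * \<eta>\<^sup>2 / 8))"
  proof -
    have "?n / 2 * (- (\<eta> / 2) - (\<eta> / 2)\<^sup>2) \<le> ?n / 2 * ln (1 - \<eta> / 2)"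
      using ln_one_minus_ge[of "\<eta> / 2"] \<eta> by (intro mult_left_mono) auto
    then have "- (\<eta> / 4 * ((1 + \<eta>) * ?n)) - ?n / 2 * ln (1 - 2 * (\<eta> / 4)) \<le> - (?n * \<eta>\<^sup>2 / 8)"
      by (simp add: field_simps power2_eq_square)
    moreover have "prob (?E (\<eta> / 4) ((1 + \<eta>) * ?n)) \<le>
        exp (- (\<eta> / 4 * ((1 + \<eta>) * ?n)) - ?n / 2 * ln (1 - 2 * (\<eta> / 4)))"
      using \<eta> by (intro prob_sum_squares_std_normal_tail[OF I ind X]) auto
    ultimately show ?thesis by (meson exp_le_cancel_iff order_trans)
  qed
  \<comment> \<open>The mirror image: the same cancellation, now from
    \<open>x - x\<^sup>2 \<le> ln (1 + x)\<close> at \<open>x = \<eta> / 2\<close>.\<close>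
  have lower: "prob (?E (- \<eta> / 4) ((1 - \<eta>) * ?n)) \<le> exp (- (?n * \<eta>\<^sup>2 / 8))"
  proof -
    have "?n / 2 * (\<eta> / 2 - (\<eta> / 2)\<^sup>2) \<le> ?n / 2 * ln (1 + \<eta> / 2)"
      using ln_one_plus_pos_lower_bound[of "\<eta> / 2"] \<eta> by (intro mult_left_mono) auto
    then have "- (- \<eta> / 4 * ((1 - \<eta>) * ?n)) - ?n / 2 * ln (1 - 2 * (- \<eta> / 4)) \<le> - (?n * \<eta>\<^sup>2 / 8)"
      by (simp add: field_simps power2_eq_square)
    moreover have "prob (?E (- \<eta> / 4) ((1 - \<eta>) * ?n)) \<le>
        exp (- (- \<eta> / 4 * ((1 - \<eta>) * ?n)) - ?n / 2 * ln (1 - 2 * (- \<eta> / 4)))"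
      using \<eta> by (intro prob_sum_squares_std_normal_tail[OF I ind X]) auto
    ultimately show ?thesis by (meson exp_le_cancel_iff order_trans)
  qed
  have "space M - ?G \<subseteq> ?E (\<eta> / 4) ((1 + \<eta>) * ?n) \<union> ?E (- \<eta> / 4) ((1 - \<eta>) * ?n)"
    using \<eta> by (auto simp: not_le)
  then have "prob (space M - ?G) \<le> prob (?E (\<eta> / 4) ((1 + \<eta>) * ?n) \<union> ?E (- \<eta> / 4) ((1 - \<eta>) * ?n))"
    by (intro finite_measure_mono) measurable
  also have "\<dots> \<le> prob (?E (\<eta> / 4) ((1 + \<eta>) * ?n)) + prob (?E (- \<eta> / 4) ((1 - \<eta>) * ?n))"
    by (intro measure_Un_le) measurable
  also have "\<dots> \<le> 2 * exp (- (?n * \<eta>\<^sup>2 / 8))"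
    using upper lower by simp
  finally show ?thesis
    by (subst (asm) prob_compl) auto
qed

section \<open>Gaussian entries and random projections\<close>

text \<open>Independence means that the joint law is the product of the marginals. The tuple of all
  coordinates is the identity map, so its law is the product measure itself.\<close>

lemma indep_vars_PiM_components:
  fixes N :: "'i \<Rightarrow> 'a measure"
  assumes N: "\<And>i. i \<in> I \<Longrightarrow> prob_space (N i)"
  shows "prob_space.indep_vars (PiM I N) N (\<lambda>i \<omega>. \<omega> i) I"
proof -
  interpret P: prob_space "PiM I N" using N by (rule prob_space_PiM)
  show ?thesis
  proof (cases "I = {}")
    \<comment> \<open>The joint-law criterion is for nonempty index sets; an empty family is
      independent by definition.\<close>
    case True
    show ?thesis unfolding P.indep_vars_def P.indep_sets_def using True by simp
  next
    case False
    have "distr (PiM I N) (PiM I N) (\<lambda>\<omega>. \<lambda>i\<in>I. \<omega> i) = distr (PiM I N) (PiM I N) (\<lambda>\<omega>. \<omega>)"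
      by (intro distr_cong) (auto simp: space_PiM)
    also have "\<dots> = (\<Pi>\<^sub>M i\<in>I. distr (PiM I N) (N i) (\<lambda>\<omega>. \<omega> i))"
      using N by (simp add: distr_id distr_PiM_component cong: PiM_cong)
    finally show ?thesis
      using False by (subst P.indep_vars_iff_distr_eq_PiM') auto
  qed
qed

lemma (in prob_space) distributed_sum_indep_std_normal:
  fixes X :: "'i \<Rightarrow> 'a \<Rightarrow> real" and c :: "'i \<Rightarrow> real"
  assumes I: "finite I" and ind: "indep_vars (\<lambda>_. borel) X I"
    and X: "\<And>i. i \<in> I \<Longrightarrow> distributed M lborel (X i) std_normal_density"
    and c: "(\<Sum>i\<in>I. (c i)\<^sup>2) = 1"
  shows "distributed M lborel (\<lambda>\<omega>. \<Sum>i\<in>I. c i * X i \<omega>) std_normal_density"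
proof -
  \<comment> \<open>Zero coefficients have to go: the library has no degenerate normal density.\<close>
  define J where "J = {i \<in> I. c i \<noteq> 0}"
  have J: "finite J" "J \<subseteq> I" using I by (auto simp: J_def)
  have cJ: "(\<Sum>i\<in>J. (c i)\<^sup>2) = 1"
    using c sum.mono_neutral_left[OF I J(2), of "\<lambda>i. (c i)\<^sup>2"] by (auto simp: J_def)
  have "distributed M lborel (\<lambda>\<omega>. \<Sum>i\<in>J. c i * X i \<omega>)
      (normal_density (\<Sum>i\<in>J. 0) (sqrt (\<Sum>i\<in>J. \<bar>c i\<bar>\<^sup>2)))"
  proof (rule sum_indep_normal)
    show "J \<noteq> {}" using cJ by auto
    show "indep_vars (\<lambda>i. borel) (\<lambda>i \<omega>. c i * X i \<omega>) J"
      using indep_vars_subset[OF ind J(2)] by (rule indep_vars_compose2) auto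
    fix i assume i: "i \<in> J"
    then show "0 < \<bar>c i\<bar>" by (simp add: J_def)
    show "distributed M lborel (\<lambda>\<omega>. c i * X i \<omega>) (normal_density 0 \<bar>c i\<bar>)"
      using normal_density_affine[OF X, of i "c i" 0] i by (simp add: J_def)
  qed (fact J)
  moreover have "(\<Sum>i\<in>J. c i * X i \<omega>) = (\<Sum>i\<in>I. c i * X i \<omega>)" for \<omega>
    using J I by (intro sum.mono_neutral_left) (auto simp: J_def)
  ultimately show ?thesis using cJ by simp
qed

lemma prob_space_std_normal: "prob_space (density lborel (\<lambda>t. ennreal (std_normal_density t)))"
  by (intro prob_space_normal_density) simp

lemma prob_space_gaussian_entries: "prob_space (gaussian_entries r n)"
  unfolding gaussian_entries_def by (intro prob_space_PiM prob_space_std_normal)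

lemma gaussian_entries_components:
  shows indep_vars_gaussian_entries:
      "prob_space.indep_vars (gaussian_entries r n) (\<lambda>_. borel) (\<lambda>k \<omega>. \<omega> k) ({..<r} \<times> {..<n})"
    and distributed_gaussian_entries:
      "k \<in> {..<r} \<times> {..<n} \<Longrightarrow> distributed (gaussian_entries r n) lborel (\<lambda>\<omega>. \<omega> k) std_normal_density"
proof -
  let ?N = "density lborel (\<lambda>t. ennreal (std_normal_density t))"
  interpret P: prob_space "gaussian_entries r n" by (rule prob_space_gaussian_entries)
  have "P.indep_vars (\<lambda>_. ?N) (\<lambda>k \<omega>. \<omega> k) ({..<r} \<times> {..<n})"
    unfolding gaussian_entries_def
    by (intro indep_vars_PiM_components prob_space_std_normal)
  \<comment> \<open>Composing with the identity replaces \<open>?N\<close> by \<open>borel\<close>,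
    which has the same measurable sets.\<close>
  then show "P.indep_vars (\<lambda>_. borel) (\<lambda>k \<omega>. \<omega> k) ({..<r} \<times> {..<n})"
    by (rule P.indep_vars_compose2[where Y = "\<lambda>_ x. x"]) simp
  assume k: "k \<in> {..<r} \<times> {..<n}"
  have "distr (gaussian_entries r n) lborel (\<lambda>\<omega>. \<omega> k) = distr (gaussian_entries r n) ?N (\<lambda>\<omega>. \<omega> k)"
    by (intro distr_cong) auto
  also have "\<dots> = ?N"
    unfolding gaussian_entries_def by (rule distr_PiM_component[OF prob_space_std_normal k])
  finally have "distr (gaussian_entries r n) lborel (\<lambda>\<omega>. \<omega> k) = ?N" .
  moreover have "(\<lambda>\<omega>. \<omega> k) \<in> measurable (gaussian_entries r n) lborel"
    using measurable_component_singleton[OF k, of "\<lambda>_. ?N"] by (simp add: gaussian_entries_def)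
  ultimately show "distributed (gaussian_entries r n) lborel (\<lambda>\<omega>. \<omega> k) std_normal_density"
    by (simp add: distributed_def)
qed

text \<open>Each entry of the projected vector, divided by \<open>sqrt Y\<close>, is standard
  normal, and different entries come from different rows. The normalized sum of squares is therefore
  chi-squared with \<open>r\<close> degrees of freedom.\<close>

lemma gaussian_projection_concentration:
  fixes y :: "nat \<Rightarrow> real" and \<eta> :: real and n r :: nat
  assumes \<eta>: "0 < \<eta>" "\<eta> \<le> 1"
  defines "Y \<equiv> \<Sum>j<n. (y j)\<^sup>2"
  shows "\<P>(\<omega> in gaussian_entries r n.
      (1 - \<eta>) * (real r * Y) \<le> (\<Sum>i<r. (\<Sum>j<n. \<omega> (i, j) * y j)\<^sup>2) \<and>
      (\<Sum>i<r. (\<Sum>j<n. \<omega> (i, j) * y j)\<^sup>2) \<le> (1 + \<eta>) * (real r * Y)) \<ge>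
    1 - 2 * exp (- (real r * \<eta>\<^sup>2 / 8))"
proof (cases "Y = 0")
  \<comment> \<open>Normalizing by \<open>sqrt Y\<close> is impossible here, but all relevant
    \<open>y j\<close> vanish, both inequalities read 0 \<le> 0 and the event is certain.\<close>
  case True
  interpret P: prob_space "gaussian_entries r n" by (rule prob_space_gaussian_entries)
  have "y j = 0" if "j < n" for j
    using True that by (simp add: Y_def sum_nonneg_eq_0_iff)
  with True show ?thesis by (simp add: P.prob_space)
next
  case False
  let ?P = "gaussian_entries r n"
  interpret P: prob_space ?P by (rule prob_space_gaussian_entries)
  have Y: "Y > 0" using False by (simp add: Y_def sum_nonneg order_less_le)
  \<comment> \<open>Summing over the index pairs of row \<open>i\<close> makes \<open>X i\<close> a
    function of that block of entries, the form needed for independence of the rows.\<close>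
  define X where "X i \<omega> = (\<Sum>k\<in>{i} \<times> {..<n}. y (snd k) / sqrt Y * \<omega> k)" for i and \<omega> :: "nat \<times> nat \<Rightarrow> real"
  have ind: "P.indep_vars (\<lambda>_. borel) X {..<r}"
  proof -
    \<comment> \<open>The rows are disjoint blocks of independent entries, so the restrictions to
      them are independent.\<close>
    have "P.indep_vars (\<lambda>i. PiM ({i} \<times> {..<n}) (\<lambda>_. borel)) (\<lambda>i \<omega>. restrict (\<lambda>k. \<omega> k) ({i} \<times> {..<n})) {..<r}"
      by (rule P.indep_vars_restrict[OF indep_vars_gaussian_entries])
         (auto simp: disjoint_family_on_def)
    then have "P.indep_vars (\<lambda>_. borel) (\<lambda>i \<omega>. X i (restrict (\<lambda>k. \<omega> k) ({i} \<times> {..<n}))) {..<r}"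
    proof (rule P.indep_vars_compose2)
      show "X i \<in> borel_measurable (PiM ({i} \<times> {..<n}) (\<lambda>_. borel))" for i
        unfolding X_def by measurable
    qed
    then show ?thesis
      by (rule iffD1[OF P.indep_vars_cong, rotated -1]) (auto simp: X_def fun_eq_iff)
  qed
  have norm: "distributed ?P lborel (X i) std_normal_density" if i: "i \<in> {..<r}" for i
    unfolding X_def
  proof (rule P.distributed_sum_indep_std_normal)
    show "P.indep_vars (\<lambda>_. borel) (\<lambda>k \<omega>. \<omega> k) ({i} \<times> {..<n})"
      using i by (intro P.indep_vars_subset[OF indep_vars_gaussian_entries]) auto
    show "distributed ?P lborel (\<lambda>\<omega>. \<omega> k) std_normal_density" if "k \<in> {i} \<times> {..<n}" for k
      using i that by (intro distributed_gaussian_entries) auto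
    have "(\<Sum>k\<in>{i} \<times> {..<n}. (y (snd k) / sqrt Y)\<^sup>2) = (\<Sum>j<n. (y j / sqrt Y)\<^sup>2)"
      by (simp add: sum.cartesian_product')
    also have "\<dots> = 1"
      using Y by (simp add: power_divide flip: sum_divide_distrib Y_def)
    finally show "(\<Sum>k\<in>{i} \<times> {..<n}. (y (snd k) / sqrt Y)\<^sup>2) = 1" .
  qed simp
  have "X i \<omega> = (\<Sum>j<n. \<omega> (i, j) * y j) / sqrt Y" for i \<omega>
    by (simp add: X_def sum_divide_distrib mult.commute sum.cartesian_product')
  then have sq: "(\<Sum>i<r. (X i \<omega>)\<^sup>2) = (\<Sum>i<r. (\<Sum>j<n. \<omega> (i, j) * y j)\<^sup>2) / Y" for \<omega>
    using Y by (simp add: power_divide flip: sum_divide_distrib)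
  show ?thesis
    using P.prob_sum_squares_std_normal_concentration[OF _ ind norm \<eta>] Y
    by (simp add: sq pos_le_divide_eq pos_divide_le_eq mult.assoc)
qed

section \<open>Quadratic forms and singular values\<close>

lemma quadratic_form_gram:
  fixes B :: rmat and x :: rvec
  assumes B: "B \<in> carrier_mat n d" and x: "x \<in> carrier_vec d"
  shows "x \<bullet> ((transpose_mat B * B) *\<^sub>v x) = (B *\<^sub>v x) \<bullet> (B *\<^sub>v x)"
proof -
  have "x \<bullet> ((transpose_mat B * B) *\<^sub>v x) = (transpose_mat B *\<^sub>v (B *\<^sub>v x)) \<bullet> x"
    using B x by (simp add: assoc_mult_mat_vec[of _ d n _ d] comm_scalar_prod[of _ d])
  also have "\<dots> = (B *\<^sub>v x) \<bullet> (B *\<^sub>v x)"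
    using B x by (subst transpose_vec_mult_scalar[of B n d]) auto
  finally show ?thesis .
qed

lemma isometry_scalar_prod:
  fixes U :: rmat and v :: rvec
  assumes U: "U \<in> carrier_mat n n" "transpose_mat U * U = 1\<^sub>m n" and v: "v \<in> carrier_vec n"
  shows "(U *\<^sub>v v) \<bullet> (U *\<^sub>v v) = v \<bullet> v"
  using quadratic_form_gram[OF U(1) v] U v by simp

text \<open>As \<open>d \<le> n\<close>, every coordinate of \<open>z\<close> meets a diagonal
  entry; the rows from \<open>d\<close> on contribute 0.\<close>

lemma diagonal_scalar_prod:
  fixes D :: rmat and z :: rvec
  assumes D: "D \<in> carrier_mat n d" "diagonal_mat D" and z: "z \<in> carrier_vec d" and "d \<le> n"
  shows "(D *\<^sub>v z) \<bullet> (D *\<^sub>v z) = (\<Sum>i<d. (D $$ (i, i))\<^sup>2 * (z $ i)\<^sup>2)"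
proof -
  have row: "(D *\<^sub>v z) $ i = (if i < d then D $$ (i, i) * z $ i else 0)" if "i < n" for i
  proof -
    have "(D *\<^sub>v z) $ i = (\<Sum>j<d. D $$ (i, j) * z $ j)"
      using D z that by (auto simp: scalar_prod_def lessThan_atLeast0)
    also have "\<dots> = (\<Sum>j<d. if j = i then D $$ (i, i) * z $ i else 0)"
      using D that by (intro sum.cong) (auto simp: diagonal_mat_def)
    finally show ?thesis by simp
  qed
  have "(D *\<^sub>v z) \<bullet> (D *\<^sub>v z) = (\<Sum>i<n. ((D *\<^sub>v z) $ i)\<^sup>2)"
    using D by (auto simp: scalar_prod_def lessThan_atLeast0 power2_eq_square simp del: index_mult_mat_vec)
  also have "\<dots> = (\<Sum>i<n. if i < d then (D $$ (i, i))\<^sup>2 * (z $ i)\<^sup>2 else 0)"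
    by (intro sum.cong) (auto simp: row power_mult_distrib)
  also have "\<dots> = (\<Sum>i<d. (D $$ (i, i))\<^sup>2 * (z $ i)\<^sup>2)"
    using \<open>d \<le> n\<close> by (intro sum.mono_neutral_cong_right) auto
  finally show ?thesis .
qed

text \<open>The isometry \<open>U\<close> drops out of the norm and leaves the diagonal factor.
  Stating this for any diagonal \<open>D\<close> lets it serve both the original and the shifted
  singular values.\<close>

lemma svd_scalar_prod:
  fixes U D V :: rmat and x :: rvec
  assumes U: "U \<in> carrier_mat n n" "inverts_mat U (transpose_mat U)"
    and V: "V \<in> carrier_mat d d" and D: "D \<in> carrier_mat n d" "diagonal_mat D"
    and x: "x \<in> carrier_vec d" and "d \<le> n"
  defines "z \<equiv> transpose_mat V *\<^sub>v x"
  shows "((U * D * transpose_mat V) *\<^sub>v x) \<bullet> ((U * D * transpose_mat V) *\<^sub>v x) =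
    (\<Sum>i<d. (D $$ (i, i))\<^sup>2 * (z $ i)\<^sup>2)"
proof -
  have z: "z \<in> carrier_vec d" using V x by (simp add: z_def)
  \<comment> \<open>\<open>inverts_mat\<close> supplies the product in the other order; for square
    matrices a one-sided inverse is two-sided.\<close>
  have "transpose_mat U * U = 1\<^sub>m n"
    using U by (intro mat_mult_left_right_inverse[of U n]) (auto simp: inverts_mat_def)
  moreover have "(U * D * transpose_mat V) *\<^sub>v x = U *\<^sub>v (D *\<^sub>v z)"
    using U V D x by (simp add: z_def assoc_mult_mat_vec[of _ n d _ d] assoc_mult_mat_vec[of _ n n _ d])
  ultimately show ?thesis
    using U D z \<open>d \<le> n\<close> by (simp add: isometry_scalar_prod diagonal_scalar_prod)
qed

text \<open>The shift adds \<open>w\<^sup>2\<close> to every squared singular value, hence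
  \<open>w\<^sup>2\<close> times the squared norm of \<open>transpose_mat V *\<^sub>v x\<close>,
  which is that of \<open>x\<close>. The condition \<open>d \<le> n\<close> ensures that all
  \<open>d\<close> directions are shifted.\<close>

lemma shift_singular_values_scalar_prod:
  fixes A U S V :: rmat and x :: rvec and w :: real
  assumes A: "A \<in> carrier_mat n d" and svd: "is_svd A U S V"
    and x: "x \<in> carrier_vec d" and "d \<le> n"
  defines "B \<equiv> U * shift_singular_values w S * transpose_mat V"
  shows "(B *\<^sub>v x) \<bullet> (B *\<^sub>v x) = directional_variance A x + w\<^sup>2 * (x \<bullet> x)"
proof -
  let ?D = "shift_singular_values w S" and ?z = "transpose_mat V *\<^sub>v x"
  have U: "U \<in> carrier_mat n n" "inverts_mat U (transpose_mat U)"
    and V: "V \<in> carrier_mat d d" "inverts_mat V (transpose_mat V)"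
    and S: "S \<in> carrier_mat n d" "diagonal_mat S" and A_eq: "A = U * S * transpose_mat V"
    using svd A by (auto simp: is_svd_def)
  have D: "?D \<in> carrier_mat n d" "diagonal_mat ?D"
    using S by (auto simp: shift_singular_values_def diagonal_mat_def)
  have "(B *\<^sub>v x) \<bullet> (B *\<^sub>v x) = (\<Sum>i<d. (?D $$ (i, i))\<^sup>2 * (?z $ i)\<^sup>2)"
    unfolding B_def by (rule svd_scalar_prod) fact+
  also have "\<dots> = (\<Sum>i<d. (S $$ (i, i))\<^sup>2 * (?z $ i)\<^sup>2 + w\<^sup>2 * (?z $ i)\<^sup>2)"
    using S \<open>d \<le> n\<close> by (intro sum.cong) (auto simp: shift_singular_values_def algebra_simps)
  also have "\<dots> = (\<Sum>i<d. (S $$ (i, i))\<^sup>2 * (?z $ i)\<^sup>2) + w\<^sup>2 * (\<Sum>i<d. (?z $ i)\<^sup>2)"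
    by (simp add: sum.distrib sum_distrib_left)
  also have "(\<Sum>i<d. (S $$ (i, i))\<^sup>2 * (?z $ i)\<^sup>2) = (A *\<^sub>v x) \<bullet> (A *\<^sub>v x)"
    unfolding A_eq using U V(1) S x \<open>d \<le> n\<close> by (rule svd_scalar_prod[symmetric])
  also have "\<dots> = directional_variance A x"
    unfolding directional_variance_def by (rule quadratic_form_gram[OF A x, symmetric])
  also have "(\<Sum>i<d. (?z $ i)\<^sup>2) = ?z \<bullet> ?z"
    using V by (auto simp: scalar_prod_def lessThan_atLeast0 power2_eq_square simp del: index_mult_mat_vec)
  \<comment> \<open>The isometry is \<open>transpose_mat V\<close>, so the identity required is that
    \<open>V * transpose_mat V\<close> is the unit matrix.\<close>
  also have "\<dots> = x \<bullet> x"
    using V x by (intro isometry_scalar_prod[of _ d]) (auto simp: inverts_mat_def)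
  finally show ?thesis .
qed

lemma smult_mat_mult_vec:
  fixes G :: rmat
  assumes "G \<in> carrier_mat m d" "x \<in> carrier_vec d"
  shows "(c \<cdot>\<^sub>m G) *\<^sub>v x = c \<cdot>\<^sub>v (G *\<^sub>v x)"
proof (rule eq_vecI)
  fix i assume "i < dim_vec (c \<cdot>\<^sub>v (G *\<^sub>v x))"
  then show "((c \<cdot>\<^sub>m G) *\<^sub>v x) $ i = (c \<cdot>\<^sub>v (G *\<^sub>v x)) $ i"
    using assms by (simp add: scalar_prod_def sum_distrib_left mult.assoc)
qed simp

text \<open>Regrouped, the released matrix is the Gram matrix of \<open>M * B\<close> divided by
  \<open>r\<close>, so its quadratic form at \<open>x\<close> is the squared norm of
  \<open>M *\<^sub>v y\<close> over \<open>r\<close>.\<close>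

lemma answer_query_released_cov:
  fixes U S V M :: rmat and x :: rvec and w :: real
  assumes carr: "U \<in> carrier_mat n n" "S \<in> carrier_mat n d" "V \<in> carrier_mat d d"
    "M \<in> carrier_mat r n" "x \<in> carrier_vec d"
  defines "y \<equiv> (U * shift_singular_values w S * transpose_mat V) *\<^sub>v x"
  shows "answer_query w (released_cov w U S V M) x =
    (\<Sum>i<r. (\<Sum>j<n. M $$ (i, j) * y $ j)\<^sup>2) / real r - w\<^sup>2"
proof -
  define B where "B = U * shift_singular_values w S * transpose_mat V"
  have B: "B \<in> carrier_mat n d"
    using carr unfolding B_def shift_singular_values_def by auto
  have y: "y \<in> carrier_vec n"
    using B carr unfolding y_def B_def[symmetric] by (intro mult_mat_vec_carrier)
  have MB: "M * B \<in> carrier_mat r d" using B carr by simp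
  have "transpose_mat B * transpose_mat M * M * B = transpose_mat B * transpose_mat M * (M * B)"
    using B carr by (intro assoc_mult_mat[of _ d r _ n _ d]) auto
  also have "\<dots> = transpose_mat (M * B) * (M * B)"
    using B carr by (simp add: transpose_mult[of M r n B d])
  finally have "transpose_mat B * transpose_mat M * M * B = transpose_mat (M * B) * (M * B)" .
  then have "x \<bullet> (released_cov w U S V M *\<^sub>v x) =
      x \<bullet> ((1 / real r) \<cdot>\<^sub>v ((transpose_mat (M * B) * (M * B)) *\<^sub>v x))"
    using MB carr unfolding released_cov_def Let_def B_def[symmetric]
    by (simp only: smult_mat_mult_vec[of _ d d] mult_carrier_mat[of _ d r] transpose_carrier_mat
        carrier_matD)
  also have "\<dots> = (1 / real r) * (x \<bullet> ((transpose_mat (M * B) * (M * B)) *\<^sub>v x))"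
    using MB carr by (intro scalar_prod_smult_distrib[of _ d]) auto
  also have "x \<bullet> ((transpose_mat (M * B) * (M * B)) *\<^sub>v x) = ((M * B) *\<^sub>v x) \<bullet> ((M * B) *\<^sub>v x)"
    using MB carr by (intro quadratic_form_gram)
  also have "(M * B) *\<^sub>v x = M *\<^sub>v y"
    using B carr by (simp add: y_def B_def[symmetric])
  also have "(M *\<^sub>v y) \<bullet> (M *\<^sub>v y) = (\<Sum>i<r. ((M *\<^sub>v y) $ i)\<^sup>2)"
    using carr by (auto simp: scalar_prod_def lessThan_atLeast0 power2_eq_square simp del: index_mult_mat_vec)
  also have "\<dots> = (\<Sum>i<r. (\<Sum>j<n. M $$ (i, j) * y $ j)\<^sup>2)"
    using carr y by (intro sum.cong) (auto simp: scalar_prod_def lessThan_atLeast0)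
  finally show ?thesis by (simp add: answer_query_def)
qed

section \<open>Centering, projection dimension and size of the additive error\<close>

text \<open>Turns a decomposition of the centered matrix into one of \<open>A\<close>
  itself.\<close>

lemma center_rows_mean_zero:
  assumes "A \<in> carrier_mat n d" "mean_row A = 0\<^sub>v d"
  shows "center_rows A = A"
  using assms by (auto simp: center_rows_def)

lemma proj_dim_ge: "8 * ln (2 / \<nu>) / \<eta>\<^sup>2 \<le> real (proj_dim \<eta> \<nu>)"
  unfolding proj_dim_def by (rule real_nat_ceiling_ge)

text \<open>The constant collects \<open>256 = 16\<^sup>2\<close> from the noise level, 18 from
  \<open>r \<le> 18 * N / \<eta>\<^sup>2\<close>, 2 from
  \<open>ln (2 / \<delta>) \<le> 2 * D\<close>, and \<open>37\<^sup>2\<close> from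
  \<open>ln (16 * r / \<delta>) \<le> 37 * ln X\<close>. The bounds by 1/2 on \<delta> and \<nu>
  keep \<open>D\<close>, \<open>N\<close> and \<open>ln X\<close> away from 0, so that additive
  constants can be absorbed.\<close>

lemma eta_noise_level_square_le:
  fixes \<delta> \<epsilon> \<eta> \<nu> :: real
  assumes \<epsilon>: "0 < \<epsilon>" and \<delta>: "0 < \<delta>" "\<delta> \<le> 1 / 2" and \<eta>: "0 < \<eta>" "\<eta> \<le> 1" and \<nu>: "0 < \<nu>" "\<nu> \<le> 1 / 2"
  shows "\<eta> * (noise_level \<epsilon> \<delta> \<eta> \<nu>)\<^sup>2 \<le> (256 * 18 * 2 * 37\<^sup>2) *
    (ln (1 / \<delta>) * ln (1 / \<nu>) / (\<epsilon>\<^sup>2 * \<eta>) * (ln (ln (1 / \<nu>) / (\<delta> * \<eta>\<^sup>2)))\<^sup>2)"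
proof -
  define N where "N = ln (1 / \<nu>)"
  define D where "D = ln (1 / \<delta>)"
  define X where "X = N / (\<delta> * \<eta>\<^sup>2)"
  define r where "r = real (proj_dim \<eta> \<nu>)"
  have ln2: "2 / 3 \<le> ln (2::real)" "ln (2::real) \<le> 1"
    using ln2_ge_two_thirds ln_2_less_1 by simp_all
  have N: "ln 2 \<le> N" and D: "ln 2 \<le> D"
    unfolding N_def D_def using \<nu> \<delta> by (auto simp: field_simps)
  have N2: "ln (2 / \<nu>) = ln 2 + N" and D2: "ln (2 / \<delta>) = ln 2 + D"
    using \<nu> \<delta> by (simp_all add: N_def D_def ln_div)
  have \<eta>2: "0 < \<eta>\<^sup>2" "\<eta>\<^sup>2 \<le> 1" using \<eta> by (simp_all add: power_le_one)
  have rhs_pos: "0 < 8 * ln (2 / \<nu>) / \<eta>\<^sup>2"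
    using N N2 ln2 \<eta>2 by (intro divide_pos_pos mult_pos_pos) linarith+
  have r_pos: "1 \<le> r"
  proof -
    have "0 < proj_dim \<eta> \<nu>"
      using rhs_pos unfolding proj_dim_def by (simp only: zero_less_nat_eq zero_less_ceiling)
    then show ?thesis unfolding r_def by linarith
  qed
  \<comment> \<open>\<open>ln 2 \<le> N\<close> gives the share 16; the 1 lost to rounding up is
    absorbed in the share 2, since \<open>N \<ge> 2 / 3\<close> and \<eta> \<le> 1.\<close>
  have r_le: "r \<le> 18 * N / \<eta>\<^sup>2"
  proof -
    have "r \<le> 8 * ln (2 / \<nu>) / \<eta>\<^sup>2 + 1"
      using rhs_pos unfolding r_def proj_dim_def by linarith
    also have "8 * ln (2 / \<nu>) / \<eta>\<^sup>2 \<le> 16 * N / \<eta>\<^sup>2"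
      using N N2 \<eta>2 by (intro divide_right_mono) linarith+
    also have "1 \<le> 2 * N / \<eta>\<^sup>2"
      using N ln2 \<eta>2 by (simp add: field_simps)
    finally show ?thesis by (simp add: add_divide_distrib[symmetric])
  qed
  have X: "4 / 3 \<le> X"
  proof -
    have "4 / 3 * (\<delta> * \<eta>\<^sup>2) \<le> 4 / 3 * (1 / 2 * 1)"
      using \<delta> \<eta>2 by (intro mult_mono) auto
    also have "\<dots> \<le> N" using N ln2 by simp
    finally show ?thesis using \<delta> \<eta>2 by (simp add: X_def pos_le_divide_eq)
  qed
  have lnX: "1 / 4 \<le> ln X"
  proof -
    have "1 / X \<le> 3 / 4" using X by (simp add: field_simps)
    moreover have "ln (1 / X) \<le> 1 / X - 1" using X by (intro ln_le_minus_one) auto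
    ultimately show ?thesis using X by (simp add: ln_div)
  qed
  \<comment> \<open>Here 16 times 18 is at most \<open>2 ^ 9\<close>, and
    \<open>9 * ln 2 \<le> 9 \<le> 36 * ln X\<close> because \<open>ln X \<ge> 1 / 4\<close>.\<close>
  have q: "0 \<le> ln (16 * r / \<delta>)" "ln (16 * r / \<delta>) \<le> 37 * ln X"
  proof -
    have "1 \<le> 16 * r / \<delta>" using r_pos \<delta> by (simp add: field_simps)
    then show "0 \<le> ln (16 * r / \<delta>)" by simp
    have "16 * r / \<delta> \<le> 16 * (18 * N / \<eta>\<^sup>2) / \<delta>"
      using r_le \<delta> by (intro divide_right_mono mult_left_mono) auto
    also have "\<dots> \<le> 2 ^ 9 * X"
      using \<delta> \<eta>2 N ln2 by (simp add: X_def field_simps)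
    finally have "ln (16 * r / \<delta>) \<le> ln (2 ^ 9 * X)"
      using r_pos \<delta> X by (subst ln_le_cancel_iff) auto
    also have "\<dots> = 9 * ln 2 + ln X"
      using X by (simp add: ln_mult ln_realpow del: power_numeral)
    finally show "ln (16 * r / \<delta>) \<le> 37 * ln X" using ln2 lnX by linarith
  qed
  have "\<eta> * (noise_level \<epsilon> \<delta> \<eta> \<nu>)\<^sup>2 = 256 * r * ln (2 / \<delta>) * (ln (16 * r / \<delta>))\<^sup>2 * (\<eta> / \<epsilon>\<^sup>2)"
    using r_pos D D2 ln2
    by (simp add: noise_level_def Let_def power_mult_distrib power_divide flip: r_def)
  also have "\<dots> \<le> 256 * (18 * N / \<eta>\<^sup>2) * (2 * D) * (37 * ln X)\<^sup>2 * (\<eta> / \<epsilon>\<^sup>2)"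
    using r_pos r_le D D2 N ln2 q \<eta> \<epsilon> by (intro mult_mono power_mono mult_nonneg_nonneg) auto
  also have "\<dots> = (256 * 18 * 2 * 37\<^sup>2) * (D * N / (\<epsilon>\<^sup>2 * \<eta>) * (ln X)\<^sup>2)"
    using \<eta> by (simp add: power2_eq_square field_simps)
  finally show ?thesis by (simp add: N_def D_def X_def)
qed

section \<open>The approximation guarantee\<close>

lemma approximates_directional_variance_released_cov:
  fixes A U S V :: rmat and w \<eta> \<nu> :: real
  assumes \<eta>: "0 < \<eta>" "\<eta> \<le> 1" and \<nu>: "0 < \<nu>" and "d \<le> n" and A: "A \<in> carrier_mat n d"
    and svd: "is_svd A U S V"
  shows "approximates_directional_variance (gaussian_entries (proj_dim \<eta> \<nu>) n)
    (\<lambda>\<omega>. answer_query w (released_cov w U S V (gaussian_mat (proj_dim \<eta> \<nu>) n \<omega>))) A \<eta> (\<eta> * w\<^sup>2) \<nu>"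
  unfolding approximates_directional_variance_def
proof (intro ballI impI)
  fix x :: rvec assume "x \<in> carrier_vec (dim_col A)" and unit: "sqrt (x \<bullet> x) = 1"
  with A have x: "x \<in> carrier_vec d" by simp
  define r where "r = proj_dim \<eta> \<nu>"
  define \<Phi> where "\<Phi> = directional_variance A x"
  let ?P = "gaussian_entries r n"
  let ?R = "\<lambda>\<omega>. answer_query w (released_cov w U S V (gaussian_mat r n \<omega>)) x"
  interpret P: prob_space ?P by (rule prob_space_gaussian_entries)
  have "1 - \<nu> \<le> \<P>(\<omega> in ?P. (1 - \<eta>) * \<Phi> - \<eta> * w\<^sup>2 \<le> ?R \<omega> \<and> ?R \<omega> \<le> (1 + \<eta>) * \<Phi> + \<eta> * w\<^sup>2)"
  proof (cases "\<nu> < 1")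
    \<comment> \<open>For \<nu> \<ge> 1 the required probability is at most 0. Otherwise
      \<open>ln (2 / \<nu>)\<close> is positive, so the projection has at least one row.\<close>
    case False
    then show ?thesis by (intro order_trans[OF _ measure_nonneg]) simp
  next
    case True
    have r_ge: "8 * ln (2 / \<nu>) / \<eta>\<^sup>2 \<le> real r"
      unfolding r_def by (rule proj_dim_ge)
    have "0 < 8 * ln (2 / \<nu>) / \<eta>\<^sup>2"
      using True \<nu> \<eta> by (intro divide_pos_pos mult_pos_pos) auto
    with r_ge have r: "0 < real r" by linarith
    have "ln (2 / \<nu>) \<le> real r * \<eta>\<^sup>2 / 8"
      using r_ge \<eta> by (simp add: pos_divide_le_eq)
    then have "exp (- (real r * \<eta>\<^sup>2 / 8)) \<le> exp (- ln (2 / \<nu>))"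
      by simp
    also have "\<dots> = \<nu> / 2"
      using \<nu> by (simp add: exp_minus)
    finally have fail: "2 * exp (- (real r * \<eta>\<^sup>2 / 8)) \<le> \<nu>" by simp
    define y where "y = (U * shift_singular_values w S * transpose_mat V) *\<^sub>v x"
    have carr: "U \<in> carrier_mat n n" "S \<in> carrier_mat n d" "V \<in> carrier_mat d d"
      using svd A by (auto simp: is_svd_def)
    have "dim_vec y = n" using carr by (simp add: y_def)
    then have "(\<Sum>j<n. (y $ j)\<^sup>2) = y \<bullet> y"
      by (simp add: scalar_prod_def lessThan_atLeast0 power2_eq_square)
    also have "\<dots> = \<Phi> + w\<^sup>2"
      using shift_singular_values_scalar_prod[OF A svd x \<open>d \<le> n\<close>, of w] unit
      by (simp add: y_def \<Phi>_def)
    finally have Y: "(\<Sum>j<n. (y $ j)\<^sup>2) = \<Phi> + w\<^sup>2" .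
    have R: "?R \<omega> = (\<Sum>i<r. (\<Sum>j<n. \<omega> (i, j) * y $ j)\<^sup>2) / real r - w\<^sup>2" for \<omega>
    proof -
      have "gaussian_mat r n \<omega> \<in> carrier_mat r n" by (simp add: gaussian_mat_def)
      from answer_query_released_cov[OF carr this x, of w]
      show ?thesis by (simp add: gaussian_mat_def y_def)
    qed
    \<comment> \<open>Dividing by \<open>r\<close> and subtracting \<open>w\<^sup>2\<close> turns
      the relative error on \<open>\<Phi> + w\<^sup>2\<close> into a relative error on
      \<open>\<Phi>\<close> plus exactly \<open>\<eta> * w\<^sup>2\<close>.\<close>
    have event: "((1 - \<eta>) * (real r * (\<Phi> + w\<^sup>2)) \<le> Q \<and> Q \<le> (1 + \<eta>) * (real r * (\<Phi> + w\<^sup>2))) \<longleftrightarrow>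
        ((1 - \<eta>) * \<Phi> - \<eta> * w\<^sup>2 \<le> Q / real r - w\<^sup>2 \<and> Q / real r - w\<^sup>2 \<le> (1 + \<eta>) * \<Phi> + \<eta> * w\<^sup>2)" for Q
      using r by (simp add: field_simps)
    show ?thesis
      using gaussian_projection_concentration[OF \<eta>, where r = r and n = n and y = "\<lambda>j. y $ j"] fail
      unfolding Y event R by linarith
  qed
  then show "1 - \<nu> \<le> \<P>(\<omega> in gaussian_entries (proj_dim \<eta> \<nu>) n.
      (1 - \<eta>) * directional_variance A x - \<eta> * w\<^sup>2
        \<le> answer_query w (released_cov w U S V (gaussian_mat (proj_dim \<eta> \<nu>) n \<omega>)) x \<and>
      answer_query w (released_cov w U S V (gaussian_mat (proj_dim \<eta> \<nu>) n \<omega>)) x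
        \<le> (1 + \<eta>) * directional_variance A x + \<eta> * w\<^sup>2)"
    by (simp add: r_def \<Phi>_def)
qed

text \<open>\<open>\<tau>\<close> and \<open>K\<close> are chosen before all other data, so
  \<open>K\<close> is absolute and the additive error depends on the four parameters alone. The
  order bound is restricted to \<delta>, \<nu> \<le> 1/2 because its right-hand side vanishes at
  \<delta> = 1. For \<open>d > n\<close> the shifted matrix would have a nontrivial kernel, so some
  directions would receive no shift.\<close>

theorem theorem5:
  shows "\<exists>(\<tau> :: real \<Rightarrow> real \<Rightarrow> real \<Rightarrow> real \<Rightarrow> real) (K :: real). K > 0 \<and>
    (\<forall>\<epsilon> \<delta> \<eta> \<nu>. 0 < \<epsilon> \<and> 0 < \<delta> \<and> 0 < \<eta> \<and> \<eta> \<le> 1 \<and> 0 < \<nu> \<longrightarrow>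
      (\<forall>n d A U S V.
        d \<le> n \<and> A \<in> carrier_mat n d \<and> mean_row A = 0\<^sub>v d \<and> is_svd (center_rows A) U S V \<longrightarrow>
        approximates_directional_variance
          (gaussian_entries (proj_dim \<eta> \<nu>) n)
          (\<lambda>\<omega>. answer_query (noise_level \<epsilon> \<delta> \<eta> \<nu>)
             (released_cov (noise_level \<epsilon> \<delta> \<eta> \<nu>) U S V (gaussian_mat (proj_dim \<eta> \<nu>) n \<omega>)))
          A \<eta> (\<tau> \<epsilon> \<delta> \<eta> \<nu>) \<nu>)) \<and>
    (\<forall>\<epsilon> \<delta> \<eta> \<nu>. 0 < \<epsilon> \<and> 0 < \<delta> \<and> \<delta> \<le> 1/2 \<and> 0 < \<eta> \<and> \<eta> \<le> 1 \<and> 0 < \<nu> \<and> \<nu> \<le> 1/2 \<longrightarrow>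
      \<tau> \<epsilon> \<delta> \<eta> \<nu> \<le> K * (ln (1 / \<delta>) * ln (1 / \<nu>) / (\<epsilon>\<^sup>2 * \<eta>) * (ln (ln (1 / \<nu>) / (\<delta> * \<eta>\<^sup>2)))\<^sup>2))"
proof (intro exI conjI allI impI)
  let ?\<tau> = "\<lambda>\<epsilon> \<delta> \<eta> \<nu>. \<eta> * (noise_level \<epsilon> \<delta> \<eta> \<nu>)\<^sup>2"
  show "(0::real) < 256 * 18 * 2 * 37\<^sup>2" by simp
  show "approximates_directional_variance
      (gaussian_entries (proj_dim \<eta> \<nu>) n)
      (\<lambda>\<omega>. answer_query (noise_level \<epsilon> \<delta> \<eta> \<nu>)
         (released_cov (noise_level \<epsilon> \<delta> \<eta> \<nu>) U S V (gaussian_mat (proj_dim \<eta> \<nu>) n \<omega>)))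
      A \<eta> (?\<tau> \<epsilon> \<delta> \<eta> \<nu>) \<nu>"
    if "0 < \<epsilon> \<and> 0 < \<delta> \<and> 0 < \<eta> \<and> \<eta> \<le> 1 \<and> 0 < \<nu>"
      and "d \<le> n \<and> A \<in> carrier_mat n d \<and> mean_row A = 0\<^sub>v d \<and> is_svd (center_rows A) U S V"
    for \<epsilon> \<delta> \<eta> \<nu> n d A U S V
    using that center_rows_mean_zero[of A n d]
    by (intro approximates_directional_variance_released_cov[of _ _ d]) auto
  show "?\<tau> \<epsilon> \<delta> \<eta> \<nu> \<le> (256 * 18 * 2 * 37\<^sup>2) *
      (ln (1 / \<delta>) * ln (1 / \<nu>) / (\<epsilon>\<^sup>2 * \<eta>) * (ln (ln (1 / \<nu>) / (\<delta> * \<eta>\<^sup>2)))\<^sup>2)"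
    if "0 < \<epsilon> \<and> 0 < \<delta> \<and> \<delta> \<le> 1/2 \<and> 0 < \<eta> \<and> \<eta> \<le> 1 \<and> 0 < \<nu> \<and> \<nu> \<le> 1/2"
    for \<epsilon> \<delta> \<eta> \<nu>
    using that by (intro eta_noise_level_square_le) auto
qed

end
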